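(* Let $\mathbf{E}$ be a set of topological spaces and $\mathbf{C}$ a set of model spaces. Define $\mathcal{F}^{\mathrm{Top}}(A,E,C)=(A,\mathrm{Triv}(E),C)$ on objects of $\mathrm{Atl}(\mathbf{E},\mathbf{C})$ and $$\mathcal{F}^{\mathrm{Top}}\bigl((f_0,f_1),(A^1,E^1,C^1),(A^2,E^2,C^2)\bigr)=\bigl((f_0,f_1),(A^1,\mathrm{Triv}(E^1),C^1),(A^2,\mathrm{Triv}(E^2),C^2)\bigr)$$ on morphisms. Then $\mathcal{F}^{\mathrm{Top}}$ is a functor from $\mathrm{Atl}(\mathbf{E},\mathbf{C})$ to $\mathrm{Atl}(\mathrm{Triv}(\mathbf{E}),\mathbf{C})$, where $\mathrm{Triv}(\mathbf{E})=\{\mathrm{Triv}(E)\mid E\in\mathbf{E}\}$.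
   Context: **Model spaces.** A model space is a pair $(S,\mathcal{S})$ where $S$ is a topological space and $\mathcal{S}$ is a small category whose objects are open subsets of $S$ and whose morphisms are continuous functions (composed as functions), such that: (1) $\mathrm{Ob}(\mathcal{S})$ is an open cover of $S$; (2) $\mathrm{Ob}(\mathcal{S})$ is closed under finite intersections; (3) if $f:A\to B$ is a morphism, $A'\subseteq A$ and $B'\subseteq B$ are objects and $f[A']\subseteq B'$, then $f|_{A'}:A'\to B'$ is a morphism; (4) inclusions $A'\hookrightarrow A$ of objects are morphisms; (5) if $f_\alpha:U_\alpha\to V_\alpha$ are morphisms, $U=\bigcup_\alpha U_\alpha$ and $V=\bigcup_\alpha V_\alpha$ are objects, and $f:U\to V$ is continuous and agrees with $f_\alpha$ on each $U_\alpha$, then $f$ is a morphism. Objects of $\mathcal{S}$ are called model neighborhoods; each is itself regarded as a model space with the full subcategory of the model neighborhoods it contains. A model function is a continuous function such that inverse images of model neighborhoods are model neighborhoods and the image of every model neighborhood is contained in a model neighborhood; a model homeomorphism is an invertible model function whose inverse is a model function. For a topological space $E$, $\mathrm{Triv}(E)$ is the model space $(E,\text{all continuous functions between open sets of }E)$. **m-charts and m-atlases.** Let $C=(|C|,\mathcal{C})$ be a model space. An m-chart of a model space $(|E|,\mathcal{E})$ in $C$ is $(U,V,\phi)$ with $U\in\mathrm{Ob}(\mathcal{E})$, $V\in\mathrm{Ob}(\mathcal{C})$ and $\phi:U\to V$ a model homeomorphism. An m-chart of a topological space $E$ in $C$ is $(U,V,\phi)$ with $U\subseteq E$ open, $V\in\mathrm{Ob}(\mathcal{C})$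 and $\phi:U\to V$ a homeomorphism mapping open sets to model neighborhoods. In both cases two m-charts $(U,V,\phi),(U',V',\phi')$ are m-compatible iff $U\cap U'=\emptyset$ or $\phi'\circ\phi^{-1}:\phi[U\cap U']\to\phi'[U\cap U']$ is an isomorphism of $\mathcal{C}$, and an m-atlas is a set of mutually m-compatible m-charts whose domains cover the total space. **m-atlas morphisms.** For model spaces $E^i$, $C^i=(|C^i|,\mathcal{C}^i)$ and m-atlases $A^i$ of $E^i$ in $C^i$, an m-atlas morphism of $A^1$ to $A^2$ is a pair of model functions $(f_0:E^1\to E^2,f_1:C^1\to C^2)$ such that for all $(U^1,V^1,\phi^1)\in A^1$, $(U^2,V^2,\phi^2)\in A^2$ and all $x\in I:=U^1\cap f_0^{-1}[U^2]$ there are model neighborhoods $U'^1\subseteq I$, $V'^1\subseteq V^1$, $U'^2\subseteq U^2$, $V'^2\subseteq V^2$, $\hat V'^2\subseteq|C^2|$ and an isomorphism $\hat f:V'^2\to\hat V'^2$ of $\mathcal{C}^2$ with $x\in U'^1$, $f_1(\phi^1(x))\in\hat V'^2$, $f_0[U'^1]\subseteq U'^2$, $\phi^1[U'^1]\subseteq V'^1$, $f_1[V'^1]\subseteq\hat V'^2$, $\phi^2[U'^2]\subseteq V'^2$, and $\hat f\circ\phi^2\circ f_0=f_1\circ\phi^1$ on $U'^1$. For topological spaces $E^i$, an m-atlas morphism of m-atlases $A^i$ of $E^i$ in $C^i$ is a pair that is an m-atlas morphism when $E^i$ is replaced by $\mathrm{Triv}(E^i)$. **The categories.** For a set $\mathbf{E}$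 of topological spaces (or of model spaces) and a set $\mathbf{C}$ of model spaces, $\mathrm{Atl}(\mathbf{E},\mathbf{C})$ has objects $(A,E,C)$ with $E\in\mathbf{E}$, $C\in\mathbf{C}$, $A$ an m-atlas of $E$ in $C$; morphisms $((f_0,f_1),(A^1,E^1,C^1),(A^2,E^2,C^2))$ with $(f_0,f_1)$ an m-atlas morphism of $A^1$ to $A^2$; composition $(g,o_2,o_3)\circ(f,o_1,o_2)=((g_0\circ f_0,g_1\circ f_1),o_1,o_3)$; and identity of $o=(A,E,C)$ equal to $((\mathrm{Id}_E,\mathrm{Id}_C),o,o)$.
   Formalization: As defined, Atl(E,C) need not be closed under composition, so it may fail to be a category; the functor laws are proved in all cases, and that both sides are categories (a functor in the full sense) is proved whenever Atl(E,C) is a category. *)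

theory Defs
  imports "HOL-Analysis.Analysis"
begin

text \<open>
  Functions between subsets of types are represented by extensional functions
  (\<open>undefined\<close> outside the domain), so that equality of HOL functions is equality of
  functions on the domain; \<^const>\<open>compose\<close> is the corresponding composition.
  A morphism of a model space is a triple (domain, codomain, function).
\<close>

record 'a mspace =
  mtop :: "'a topology"
  nbds :: "'a set set"
  mors :: "('a set \<times> 'a set \<times> ('a \<Rightarrow> 'a)) set"

abbreviation pts :: "'a mspace \<Rightarrow> 'a set" where
  "pts M \<equiv> topspace (mtop M)"

abbreviation idon :: "'a set \<Rightarrow> 'a \<Rightarrow> 'a" where
  "idon A \<equiv> restrict (\<lambda>x. x) A"

definition cont_fun :: "'a topology \<Rightarrow> 'b topology \<Rightarrow> ('a \<Rightarrow> 'b) \<Rightarrow> bool" where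
  "cont_fun X Y f \<longleftrightarrow> f \<in> extensional (topspace X) \<and> continuous_map X Y f"

text \<open>
  The identity morphism of a model neighborhood \<open>A\<close> is provided by the inclusion axiom
  with \<open>A' = A\<close>.  Closure under finite intersections means closure under intersections of
  finitely many, but at least one, model neighborhoods: the whole space is not required to be
  a model neighborhood.
\<close>

definition model_space :: "'a mspace \<Rightarrow> bool" where
  "model_space M \<longleftrightarrow>
     (\<forall>A\<in>nbds M. openin (mtop M) A) \<and>
     (\<forall>(A, B, f)\<in>mors M. A \<in> nbds M \<and> B \<in> nbds M \<and>
        cont_fun (subtopology (mtop M) A) (subtopology (mtop M) B) f) \<and>
     (\<forall>A B D f g. (A, B, f) \<in> mors M \<longrightarrow> (B, D, g) \<in> mors M \<longrightarrow> (A, D, compose A g f) \<in> mors M) \<and>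
     \<Union> (nbds M) = pts M \<and>
     (\<forall>A\<in>nbds M. \<forall>B\<in>nbds M. A \<inter> B \<in> nbds M) \<and>
     (\<forall>A B f A' B'. (A, B, f) \<in> mors M \<longrightarrow> A' \<in> nbds M \<longrightarrow> B' \<in> nbds M \<longrightarrow>
        A' \<subseteq> A \<longrightarrow> B' \<subseteq> B \<longrightarrow> f ` A' \<subseteq> B' \<longrightarrow> (A', B', restrict f A') \<in> mors M) \<and>
     (\<forall>A\<in>nbds M. \<forall>A'\<in>nbds M. A' \<subseteq> A \<longrightarrow> (A', A, idon A') \<in> mors M) \<and>
     (\<forall>F U V f. F \<subseteq> mors M \<longrightarrow> U \<in> nbds M \<longrightarrow> V \<in> nbds M \<longrightarrow>
        U = (\<Union>(A, B, h)\<in>F. A) \<longrightarrow> V = (\<Union>(A, B, h)\<in>F. B) \<longrightarrow>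
        cont_fun (subtopology (mtop M) U) (subtopology (mtop M) V) f \<longrightarrow>
        (\<forall>(A, B, h)\<in>F. \<forall>x\<in>A. f x = h x) \<longrightarrow> (U, V, f) \<in> mors M)"

definition msub :: "'a mspace \<Rightarrow> 'a set \<Rightarrow> 'a mspace" where
  "msub M U = \<lparr> mtop = subtopology (mtop M) U,
                nbds = {A \<in> nbds M. A \<subseteq> U},
                mors = {(A, B, f) \<in> mors M. A \<subseteq> U \<and> B \<subseteq> U} \<rparr>"

definition Triv :: "'a topology \<Rightarrow> 'a mspace" where
  "Triv E = \<lparr> mtop = E,
              nbds = {U. openin E U},
              mors = {(A, B, f). openin E A \<and> openin E B \<and>
                                 cont_fun (subtopology E A) (subtopology E B) f} \<rparr>"

text \<open>
  A model function is not required to be compatible with the morphisms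
  of the two model categories.
\<close>

definition model_function :: "'a mspace \<Rightarrow> 'b mspace \<Rightarrow> ('a \<Rightarrow> 'b) \<Rightarrow> bool" where
  "model_function M N f \<longleftrightarrow>
     cont_fun (mtop M) (mtop N) f \<and>
     (\<forall>V\<in>nbds N. {x \<in> pts M. f x \<in> V} \<in> nbds M) \<and>
     (\<forall>U\<in>nbds M. \<exists>V\<in>nbds N. f ` U \<subseteq> V)"

definition model_homeo :: "'a mspace \<Rightarrow> 'b mspace \<Rightarrow> ('a \<Rightarrow> 'b) \<Rightarrow> bool" where
  "model_homeo M N f \<longleftrightarrow>
     model_function M N f \<and>
     (\<exists>g. model_function N M g \<and> (\<forall>x\<in>pts M. g (f x) = x) \<and> (\<forall>y\<in>pts N. f (g y) = y))"

definition mor_iso :: "'a mspace \<Rightarrow> 'a set \<Rightarrow> 'a set \<Rightarrow> ('a \<Rightarrow> 'a) \<Rightarrow> bool" where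
  "mor_iso M A B f \<longleftrightarrow>
     (A, B, f) \<in> mors M \<and>
     (\<exists>g. (B, A, g) \<in> mors M \<and> compose A g f = idon A \<and> compose B f g = idon B)"

type_synonym ('a, 'b) chart = "'a set \<times> 'b set \<times> ('a \<Rightarrow> 'b)"

definition mchart :: "'a mspace \<Rightarrow> 'b mspace \<Rightarrow> ('a, 'b) chart \<Rightarrow> bool" where
  "mchart E C = (\<lambda>(U, V, \<phi>).
     U \<in> nbds E \<and> V \<in> nbds C \<and> model_homeo (msub E U) (msub C V) \<phi>)"

definition mchart_top :: "'a topology \<Rightarrow> 'b mspace \<Rightarrow> ('a, 'b) chart \<Rightarrow> bool" where
  "mchart_top E C = (\<lambda>(U, V, \<phi>).
     openin E U \<and> V \<in> nbds C \<and> \<phi> \<in> extensional U \<and>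
     homeomorphic_map (subtopology E U) (subtopology (mtop C) V) \<phi> \<and>
     (\<forall>W. openin (subtopology E U) W \<longrightarrow> \<phi> ` W \<in> nbds C))"

definition mcompatible :: "'b mspace \<Rightarrow> ('a, 'b) chart \<Rightarrow> ('a, 'b) chart \<Rightarrow> bool" where
  "mcompatible C = (\<lambda>(U, V, \<phi>) (U', V', \<phi>').
     U \<inter> U' = {} \<or>
     mor_iso C (\<phi> ` (U \<inter> U')) (\<phi>' ` (U \<inter> U'))
       (restrict (\<lambda>y. \<phi>' (inv_into U \<phi> y)) (\<phi> ` (U \<inter> U'))))"

definition matlas :: "('a, 'b) chart set \<Rightarrow> 'a mspace \<Rightarrow> 'b mspace \<Rightarrow> bool" where
  "matlas A E C \<longleftrightarrow>
     (\<forall>c\<in>A. mchart E C c) \<and> (\<forall>c\<in>A. \<forall>c'\<in>A. mcompatible C c c') \<and>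
     (\<Union>(U, V, \<phi>)\<in>A. U) = pts E"

definition matlas_top :: "('a, 'b) chart set \<Rightarrow> 'a topology \<Rightarrow> 'b mspace \<Rightarrow> bool" where
  "matlas_top A E C \<longleftrightarrow>
     (\<forall>c\<in>A. mchart_top E C c) \<and> (\<forall>c\<in>A. \<forall>c'\<in>A. mcompatible C c c') \<and>
     (\<Union>(U, V, \<phi>)\<in>A. U) = topspace E"

type_synonym ('a, 'b, 'e) atlobj = "('a, 'b) chart set \<times> 'e \<times> 'b mspace"

definition atlas_morphism ::
  "('a, 'b, 'a mspace) atlobj \<Rightarrow> ('a, 'b, 'a mspace) atlobj \<Rightarrow> ('a \<Rightarrow> 'a) \<times> ('b \<Rightarrow> 'b) \<Rightarrow> bool" where
  "atlas_morphism = (\<lambda>(A1, E1, C1) (A2, E2, C2) (f0, f1).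
     model_function E1 E2 f0 \<and> model_function C1 C2 f1 \<and>
     (\<forall>(U1, V1, \<phi>1)\<in>A1. \<forall>(U2, V2, \<phi>2)\<in>A2. \<forall>x \<in> {x \<in> U1. f0 x \<in> U2}.
        \<exists>U1' V1' U2' V2' V2h fh.
          U1' \<in> nbds E1 \<and> U1' \<subseteq> {x \<in> U1. f0 x \<in> U2} \<and>
          V1' \<in> nbds C1 \<and> V1' \<subseteq> V1 \<and>
          U2' \<in> nbds E2 \<and> U2' \<subseteq> U2 \<and>
          V2' \<in> nbds C2 \<and> V2' \<subseteq> V2 \<and>
          V2h \<in> nbds C2 \<and> mor_iso C2 V2' V2h fh \<and>
          x \<in> U1' \<and> f1 (\<phi>1 x) \<in> V2h \<and>
          f0 ` U1' \<subseteq> U2' \<and> \<phi>1 ` U1' \<subseteq> V1' \<and> f1 ` V1' \<subseteq> V2h \<and> \<phi>2 ` U2' \<subseteq> V2' \<and>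
          (\<forall>z\<in>U1'. fh (\<phi>2 (f0 z)) = f1 (\<phi>1 z))))"

definition FTop_obj :: "('a, 'b, 'a topology) atlobj \<Rightarrow> ('a, 'b, 'a mspace) atlobj" where
  "FTop_obj = (\<lambda>(A, E, C). (A, Triv E, C))"

definition atlas_morphism_top ::
  "('a, 'b, 'a topology) atlobj \<Rightarrow> ('a, 'b, 'a topology) atlobj \<Rightarrow>
     ('a \<Rightarrow> 'a) \<times> ('b \<Rightarrow> 'b) \<Rightarrow> bool" where
  "atlas_morphism_top = (\<lambda>(A1, E1, C1) (A2, E2, C2).
     atlas_morphism (A1, Triv E1, C1) (A2, Triv E2, C2))"

text \<open>
  The data of a category: objects, morphisms, domain, codomain, identities, composition
  (\<open>Comp g f\<close> is \<open>g\<close> after \<open>f\<close>, relevant only if \<open>Cod f = Dom g\<close>).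
\<close>

record ('o, 'm) catdata =
  Ob :: "'o set"
  Ar :: "'m set"
  Dom :: "'m \<Rightarrow> 'o"
  Cod :: "'m \<Rightarrow> 'o"
  Idt :: "'o \<Rightarrow> 'm"
  Comp :: "'m \<Rightarrow> 'm \<Rightarrow> 'm"

definition is_category :: "('o, 'm) catdata \<Rightarrow> bool" where
  "is_category S \<longleftrightarrow>
     (\<forall>f\<in>Ar S. Dom S f \<in> Ob S \<and> Cod S f \<in> Ob S) \<and>
     (\<forall>a\<in>Ob S. Idt S a \<in> Ar S \<and> Dom S (Idt S a) = a \<and> Cod S (Idt S a) = a) \<and>
     (\<forall>f\<in>Ar S. \<forall>g\<in>Ar S. Cod S f = Dom S g \<longrightarrow>
        Comp S g f \<in> Ar S \<and> Dom S (Comp S g f) = Dom S f \<and> Cod S (Comp S g f) = Cod S g) \<and>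
     (\<forall>f\<in>Ar S. Comp S f (Idt S (Dom S f)) = f \<and> Comp S (Idt S (Cod S f)) f = f) \<and>
     (\<forall>f\<in>Ar S. \<forall>g\<in>Ar S. \<forall>h\<in>Ar S. Cod S f = Dom S g \<longrightarrow> Cod S g = Dom S h \<longrightarrow>
        Comp S h (Comp S g f) = Comp S (Comp S h g) f)"

definition functor_laws ::
  "('o, 'm) catdata \<Rightarrow> ('p, 'n) catdata \<Rightarrow> ('o \<Rightarrow> 'p) \<Rightarrow> ('m \<Rightarrow> 'n) \<Rightarrow> bool" where
  "functor_laws S T Fo Fm \<longleftrightarrow>
     (\<forall>a\<in>Ob S. Fo a \<in> Ob T) \<and>
     (\<forall>f\<in>Ar S. Fm f \<in> Ar T \<and> Dom T (Fm f) = Fo (Dom S f) \<and> Cod T (Fm f) = Fo (Cod S f)) \<and>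
     (\<forall>a\<in>Ob S. Fm (Idt S a) = Idt T (Fo a)) \<and>
     (\<forall>f\<in>Ar S. \<forall>g\<in>Ar S. Cod S f = Dom S g \<longrightarrow> Fm (Comp S g f) = Comp T (Fm g) (Fm f))"

definition is_functor ::
  "('o, 'm) catdata \<Rightarrow> ('p, 'n) catdata \<Rightarrow> ('o \<Rightarrow> 'p) \<Rightarrow> ('m \<Rightarrow> 'n) \<Rightarrow> bool" where
  "is_functor S T Fo Fm \<longleftrightarrow> is_category S \<and> is_category T \<and> functor_laws S T Fo Fm"

text \<open>
  \<open>Atl(E, C)\<close> for topological spaces and for model spaces differ only in the notions of
  underlying set, m-atlas and m-atlas morphism, which are the first three parameters here.

  Composition is componentwise.  Because model functions need not respect
  model morphisms, a composite of two m-atlas morphisms need not be an m-atlas morphism: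
  let \<open>I\<close> be the model space on the reals with all open sets and only the inclusions as
  morphisms, and let every atlas be \<open>{(\<real>, \<real>, id)}\<close>; then
  \<open>(id, uminus) : Triv \<real> \<rightarrow> Triv \<real>\<close> (coordinates in \<open>Triv \<real>\<close>) and
  \<open>(id, id) : Triv \<real> \<rightarrow> Triv \<real>\<close> (coordinates from \<open>Triv \<real>\<close> to \<open>I\<close>) are m-atlas
  morphisms, but \<open>(id, uminus)\<close> with coordinates from \<open>Triv \<real>\<close> to \<open>I\<close> is not.
  Hence these data satisfy \<^const>\<open>is_category\<close> only for suitable sets of spaces, and
  \<^const>\<open>functor_laws\<close> is kept separate from \<^const>\<open>is_category\<close>.
\<close>

type_synonym ('a, 'b, 'e) atlmor =
  "(('a \<Rightarrow> 'a) \<times> ('b \<Rightarrow> 'b)) \<times> ('a, 'b, 'e) atlobj \<times> ('a, 'b, 'e) atlobj"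

definition atl_data ::
  "('e \<Rightarrow> 'a set) \<Rightarrow> (('a, 'b) chart set \<Rightarrow> 'e \<Rightarrow> 'b mspace \<Rightarrow> bool) \<Rightarrow>
   (('a, 'b, 'e) atlobj \<Rightarrow> ('a, 'b, 'e) atlobj \<Rightarrow> ('a \<Rightarrow> 'a) \<times> ('b \<Rightarrow> 'b) \<Rightarrow> bool) \<Rightarrow>
   'e set \<Rightarrow> 'b mspace set \<Rightarrow> (('a, 'b, 'e) atlobj, ('a, 'b, 'e) atlmor) catdata" where
  "atl_data car atlas mor EE CC =
     (let obs = {(A, E, C). E \<in> EE \<and> C \<in> CC \<and> atlas A E C} in
      \<lparr> Ob = obs,
        Ar = {(f, o1, o2). o1 \<in> obs \<and> o2 \<in> obs \<and> mor o1 o2 f},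
        Dom = (\<lambda>(f, o1, o2). o1),
        Cod = (\<lambda>(f, o1, o2). o2),
        Idt = (\<lambda>(A, E, C). ((idon (car E), idon (pts C)), (A, E, C), (A, E, C))),
        Comp = (\<lambda>((g0, g1), o2, o3) ((f0, f1), (A1, E1, C1), o2').
                  ((compose (car E1) g0 f0, compose (pts C1) g1 f1), (A1, E1, C1), o3)) \<rparr>)"

definition Atl_top where
  "Atl_top = atl_data topspace matlas_top atlas_morphism_top"

definition Atl_mod where
  "Atl_mod = atl_data pts matlas atlas_morphism"

definition FTop_mor :: "('a, 'b, 'a topology) atlmor \<Rightarrow> ('a, 'b, 'a mspace) atlmor" where
  "FTop_mor = (\<lambda>(f, o1, o2). (f, FTop_obj o1, FTop_obj o2))"

end

theory Submission
  imports Defs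
begin

text \<open>
  Over a trivial model space the two notions of chart coincide: every open subset of \<open>E\<close> is a
  model neighborhood of \<open>Triv E\<close>, so a homeomorphism \<open>\<phi>\<close> of \<open>U\<close> onto \<open>V\<close> is automatically a model
  function because the model neighborhoods of \<open>C\<close> are open, while its inverse is a model function
  precisely when \<open>\<phi>\<close> maps open sets to model neighborhoods
  (\<open>mchart_Triv_iff\<close>). Compatibility of charts does not mention the model structure of the total
  space, and morphisms of atlases of topological spaces are defined through \<open>Triv\<close>.
  Therefore \<open>(A, E, C) \<mapsto> (A, Triv E, C)\<close> maps the objects and morphisms of \<open>Atl_top EE CC\<close>
  onto those of \<open>Atl_mod (Triv ` EE) CC\<close>, leaving the underlying functions unchanged, and
  preservation of identities and composition is immediate as \<open>E\<close> and \<open>Triv E\<close> have the same points.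

  For the conditional part, \<open>E\<close> can be recovered from \<open>Triv E\<close>, so the assignment on objects is
  injective. Composable morphisms of the target thus lift to composable morphisms of the
  source, and every category axiom is transported along the functor
  (\<open>is_category_image\<close>).
\<close>

section \<open>Charts of trivial model spaces\<close>

lemma Triv_simps [simp]:
  "mtop (Triv E) = E" "nbds (Triv E) = {U. openin E U}"
  by (simp_all add: Triv_def)

lemma inj_Triv: "inj Triv"
  by (metis Triv_simps(1) injI)

lemma msub_simps [simp]:
  "mtop (msub M U) = subtopology (mtop M) U" "nbds (msub M U) = {A \<in> nbds M. A \<subseteq> U}"
  by (simp_all add: msub_def)

lemma openin_nbds: "model_space M \<Longrightarrow> A \<in> nbds M \<Longrightarrow> openin (mtop M) A"
  by (simp add: model_space_def)

lemma topspace_subtopology_openin: "openin X U \<Longrightarrow> topspace (subtopology X U) = U"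
  by (metis openin_subset topspace_subtopology_subset)

lemma mchart_Triv_if_mchart_top:
  assumes C: "model_space C" and c: "mchart_top E C (U, V, \<phi>)"
  shows "mchart (Triv E) C (U, V, \<phi>)"
proof -
  let ?X = "subtopology E U" and ?Y = "subtopology (mtop C) V"
  from c have U: "openin E U" and V: "V \<in> nbds C" and ext: "\<phi> \<in> extensional U"
    and hom: "homeomorphic_map ?X ?Y \<phi>"
    and img: "\<And>W. openin ?X W \<Longrightarrow> \<phi> ` W \<in> nbds C"
    by (auto simp: mchart_top_def)
  have oV: "openin (mtop C) V" using C V by (rule openin_nbds)
  have tX: "topspace ?X = U" and tY: "topspace ?Y = V"
    using U oV by (simp_all only: topspace_subtopology_openin)
  obtain \<psi> where \<psi>: "homeomorphic_maps ?X ?Y \<phi> \<psi>"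
    using hom homeomorphic_map_maps by blast
  have cont: "continuous_map ?X ?Y \<phi>" "continuous_map ?Y ?X \<psi>"
    and inv: "\<And>x. x \<in> U \<Longrightarrow> \<psi> (\<phi> x) = x" "\<And>y. y \<in> V \<Longrightarrow> \<phi> (\<psi> y) = y"
    using \<psi> by (auto simp: homeomorphic_maps_def tX tY simp del: topspace_subtopology)
  have maps: "\<And>x. x \<in> U \<Longrightarrow> \<phi> x \<in> V" "\<And>y. y \<in> V \<Longrightarrow> \<psi> y \<in> U"
    using cont by (auto simp: continuous_map_def tX tY simp del: topspace_subtopology)
  \<comment> \<open>Model functions are extensional, whereas \<open>\<psi>\<close> is arbitrary outside \<open>V\<close>.\<close>
  let ?g = "restrict \<psi> V"
  have "model_function (msub (Triv E) U) (msub C V) \<phi>"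
    unfolding model_function_def
  proof (intro conjI ballI)
    show "cont_fun (mtop (msub (Triv E) U)) (mtop (msub C V)) \<phi>"
      using cont ext tX by (simp add: cont_fun_def)
  next
    fix W assume "W \<in> nbds (msub C V)"
    then have "openin ?Y W"
      using C by (simp add: openin_nbds openin_open_subtopology oV)
    then have "openin ?X {x \<in> topspace ?X. \<phi> x \<in> W}"
      using cont(1) by (rule openin_continuous_map_preimage[rotated])
    then show "{x \<in> pts (msub (Triv E) U). \<phi> x \<in> W} \<in> nbds (msub (Triv E) U)"
      using U tX by (simp add: openin_open_subtopology del: topspace_subtopology)
  next
    fix W assume "W \<in> nbds (msub (Triv E) U)"
    then show "\<exists>W'\<in>nbds (msub C V). \<phi> ` W \<subseteq> W'"
      using V maps(1) by (intro bexI[of _ V]) auto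
  qed
  moreover have "model_function (msub C V) (msub (Triv E) U) ?g"
    unfolding model_function_def
  proof (intro conjI ballI)
    show "cont_fun (mtop (msub C V)) (mtop (msub (Triv E) U)) ?g"
      using cont(2) tY continuous_map_eq[of ?Y ?X \<psi> ?g] by (simp add: cont_fun_def)
  next
    fix W assume W: "W \<in> nbds (msub (Triv E) U)"
    \<comment> \<open>The preimage of \<open>W\<close> under the inverse is its image under the chart.\<close>
    have "{y \<in> V. ?g y \<in> W} = \<phi> ` W"
      using W inv maps by force
    moreover have "openin ?X W"
      using W U by (simp add: openin_open_subtopology)
    ultimately show "{y \<in> pts (msub C V). ?g y \<in> W} \<in> nbds (msub C V)"
      using img tY W maps(1) by auto
  next
    fix W assume "W \<in> nbds (msub C V)"
    then show "\<exists>W'\<in>nbds (msub (Triv E) U). ?g ` W \<subseteq> W'"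
      using U maps(2) by (intro bexI[of _ U]) auto
  qed
  ultimately have "model_homeo (msub (Triv E) U) (msub C V) \<phi>"
    unfolding model_homeo_def using inv maps tX tY by (auto intro!: exI[of _ ?g])
  then show ?thesis
    using U V by (simp add: mchart_def)
qed

lemma mchart_top_if_mchart_Triv:
  assumes C: "model_space C" and c: "mchart (Triv E) C (U, V, \<phi>)"
  shows "mchart_top E C (U, V, \<phi>)"
proof -
  let ?X = "subtopology E U" and ?Y = "subtopology (mtop C) V"
  from c have U: "openin E U" and V: "V \<in> nbds C"
    and mh: "model_homeo (msub (Triv E) U) (msub C V) \<phi>"
    by (auto simp: mchart_def)
  have oV: "openin (mtop C) V" using C V by (rule openin_nbds)
  have tX: "topspace ?X = U" and tY: "topspace ?Y = V"
    using U oV by (simp_all only: topspace_subtopology_openin)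
  obtain g where f: "model_function (msub (Triv E) U) (msub C V) \<phi>"
    and g: "model_function (msub C V) (msub (Triv E) U) g"
    and inv: "\<And>x. x \<in> U \<Longrightarrow> g (\<phi> x) = x" "\<And>y. y \<in> V \<Longrightarrow> \<phi> (g y) = y"
    using mh by (auto simp: model_homeo_def tX tY simp del: topspace_subtopology)
  have cont: "continuous_map ?X ?Y \<phi>" "continuous_map ?Y ?X g" and ext: "\<phi> \<in> extensional U"
    using f g tX by (auto simp: model_function_def cont_fun_def)
  have "homeomorphic_maps ?X ?Y \<phi> g"
    using cont inv tX tY by (simp add: homeomorphic_maps_def)
  then have hom: "homeomorphic_map ?X ?Y \<phi>"
    using homeomorphic_map_maps by blast
  have "\<phi> ` W \<in> nbds C" if W: "openin ?X W" for W
  proof -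
    have WU: "openin E W" "W \<subseteq> U"
      using W U openin_open_subtopology by blast+
    have "{y \<in> V. g y \<in> W} \<in> nbds C"
      using g WU tY by (simp add: model_function_def del: topspace_subtopology)
    moreover have "{y \<in> V. g y \<in> W} = \<phi> ` W"
      using WU inv cont(1) by (force simp: continuous_map_def tX tY simp del: topspace_subtopology)
    ultimately show ?thesis by simp
  qed
  then show ?thesis
    using U V ext hom by (simp add: mchart_top_def)
qed

lemma mchart_Triv_iff: "model_space C \<Longrightarrow> mchart (Triv E) C c \<longleftrightarrow> mchart_top E C c"
  by (metis mchart_Triv_if_mchart_top mchart_top_if_mchart_Triv prod_cases3)

lemma matlas_Triv_iff: "model_space C \<Longrightarrow> matlas A (Triv E) C \<longleftrightarrow> matlas_top A E C"
  by (simp add: matlas_def matlas_top_def mchart_Triv_iff)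

section \<open>Transport of the category axioms\<close>

text \<open>
  The image of a functor that is injective on objects is closed under composition, since a
  composable pair in the image lifts to a composable pair. If the functor is moreover onto, each
  axiom of the target is the image of the same axiom of the source.
\<close>
lemma is_category_image:
  assumes S: "is_category S" and F: "functor_laws S T Fo Fm"
    and inj: "inj_on Fo (Ob S)" and Ob: "Fo ` Ob S = Ob T" and Ar: "Fm ` Ar S = Ar T"
  shows "is_category T"
proof -
  have S_ends: "Dom S f \<in> Ob S" "Cod S f \<in> Ob S" if "f \<in> Ar S" for f
    using S that by (auto simp: is_category_def)
  have S_id: "Idt S a \<in> Ar S" "Dom S (Idt S a) = a" "Cod S (Idt S a) = a" if "a \<in> Ob S" for a
    using S that by (auto simp: is_category_def)
  have S_comp: "Comp S g f \<in> Ar S" "Dom S (Comp S g f) = Dom S f" "Cod S (Comp S g f) = Cod S g"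
    if "f \<in> Ar S" "g \<in> Ar S" "Cod S f = Dom S g" for f g
    using S that by (auto simp: is_category_def)
  have S_unit: "Comp S f (Idt S (Dom S f)) = f" "Comp S (Idt S (Cod S f)) f = f"
    if "f \<in> Ar S" for f
    using S that by (auto simp: is_category_def)
  have S_assoc: "Comp S h (Comp S g f) = Comp S (Comp S h g) f"
    if "f \<in> Ar S" "g \<in> Ar S" "h \<in> Ar S" "Cod S f = Dom S g" "Cod S g = Dom S h" for f g h
    using S that by (auto simp: is_category_def)
  have F_ends: "Dom T (Fm f) = Fo (Dom S f)" "Cod T (Fm f) = Fo (Cod S f)" if "f \<in> Ar S" for f
    using F that by (auto simp: functor_laws_def)
  have F_id: "Idt T (Fo a) = Fm (Idt S a)" if "a \<in> Ob S" for a
    using F that by (auto simp: functor_laws_def)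
  have F_comp: "Comp T (Fm g) (Fm f) = Fm (Comp S g f)"
    if "f \<in> Ar S" "g \<in> Ar S" "Cod S f = Dom S g" for f g
    using F that by (auto simp: functor_laws_def)
  have lift: "Fo (Cod S f) = Fo (Dom S g) \<longleftrightarrow> Cod S f = Dom S g"
    if "f \<in> Ar S" "g \<in> Ar S" for f g
    using inj S_ends that by (auto dest: inj_onD)
  show ?thesis
    unfolding is_category_def Ob[symmetric] Ar[symmetric]
    by (simp add: S_ends S_id S_comp S_unit S_assoc F_ends F_id F_comp lift)
qed

section \<open>The functor to model spaces\<close>

lemma inj_FTop_obj: "inj FTop_obj"
  by (auto simp: FTop_obj_def intro!: injI dest: injD[OF inj_Triv])

lemma Ob_Atl_mod_Triv:
  assumes "\<forall>C\<in>CC. model_space C"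
  shows "Ob (Atl_mod (Triv ` EE) CC) = FTop_obj ` Ob (Atl_top EE CC)"
  using assms
  by (fastforce simp: Atl_mod_def Atl_top_def atl_data_def FTop_obj_def matlas_Triv_iff image_iff)

lemma Ar_Atl_mod_Triv:
  fixes EE :: "'a topology set" and CC :: "'b mspace set"
  assumes "\<forall>C\<in>CC. model_space C"
  shows "Ar (Atl_mod (Triv ` EE) CC) = FTop_mor ` Ar (Atl_top EE CC)"
proof -
  have top: "atlas_morphism (FTop_obj o1) (FTop_obj o2) f \<longleftrightarrow> atlas_morphism_top o1 o2 f"
    for o1 o2 :: "('a, 'b, 'a topology) atlobj" and f
    by (auto simp: atlas_morphism_top_def FTop_obj_def split: prod.split)
  have Ar_mod: "Ar (Atl_mod (Triv ` EE) CC) =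
      {(f, o1, o2). o1 \<in> Ob (Atl_mod (Triv ` EE) CC) \<and> o2 \<in> Ob (Atl_mod (Triv ` EE) CC) \<and>
        atlas_morphism o1 o2 f}"
    by (simp add: Atl_mod_def atl_data_def)
  have Ar_top: "Ar (Atl_top EE CC) =
      {(f, o1, o2). o1 \<in> Ob (Atl_top EE CC) \<and> o2 \<in> Ob (Atl_top EE CC) \<and>
        atlas_morphism_top o1 o2 f}"
    by (simp add: Atl_top_def atl_data_def)
  \<comment> \<open>For an arbitrary relabelling \<open>h\<close> of the end points, so that objects stay unsplit.\<close>
  have image: "{(f, o1, o2). o1 \<in> h ` X \<and> o2 \<in> h ` X \<and> P o1 o2 f} =
      (\<lambda>(f, o1, o2). (f, h o1, h o2)) ` {(f, o1, o2). o1 \<in> X \<and> o2 \<in> X \<and> Q o1 o2 f}"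
    if "\<And>o1 o2 f. P (h o1) (h o2) f \<longleftrightarrow> Q o1 o2 f" for h X P Q
  proof (intro equalityI subsetI; clarify)
    fix f a b assume "P (h a) (h b) f" "a \<in> X" "b \<in> X"
    then show "(f, h a, h b) \<in> (\<lambda>(f, o1, o2). (f, h o1, h o2)) `
        {(f, o1, o2). o1 \<in> X \<and> o2 \<in> X \<and> Q o1 o2 f}"
      using that by (intro image_eqI[where x = "(f, a, b)"]) auto
  next
    fix f a b assume "Q a b f" "a \<in> X" "b \<in> X"
    then show "h a \<in> h ` X \<and> h b \<in> h ` X \<and> P (h a) (h b) f"
      using that by simp
  qed
  show ?thesis
    unfolding Ar_mod Ar_top Ob_Atl_mod_Triv[OF assms] FTop_mor_def
    by (rule image) (rule top)
qed

lemma functor_laws_FTop: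
  assumes "\<forall>C\<in>CC. model_space C"
  shows "functor_laws (Atl_top EE CC) (Atl_mod (Triv ` EE) CC) FTop_obj FTop_mor"
  unfolding functor_laws_def Ob_Atl_mod_Triv[OF assms] Ar_Atl_mod_Triv[OF assms]
  by (auto simp: Atl_mod_def Atl_top_def atl_data_def FTop_obj_def FTop_mor_def)

theorem theorem8p33:
  fixes EE :: "'a topology set" and CC :: "'b mspace set"
  assumes "\<forall>C\<in>CC. model_space C"
  shows "functor_laws (Atl_top EE CC) (Atl_mod (Triv ` EE) CC) FTop_obj FTop_mor \<and>
         (is_category (Atl_top EE CC) \<longrightarrow>
            is_functor (Atl_top EE CC) (Atl_mod (Triv ` EE) CC) FTop_obj FTop_mor)"
  using functor_laws_FTop[OF assms] is_category_image[OF _ functor_laws_FTop[OF assms]]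
    inj_on_subset[OF inj_FTop_obj subset_UNIV]
    Ob_Atl_mod_Triv[OF assms] Ar_Atl_mod_Triv[OF assms]
  unfolding is_functor_def by metis

end
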